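(* Let $K$ be a Hausdorff space and let $A$ be a (closed linear) subspace of $C_b(K)$. (i) If $f$ is a strong peak function in $A$, then every norming sequence of $f$ approaches for $A$. Hence the norm $\|\cdot\|$ of $A$ is Gâteaux differentiable at every strong peak function. (ii) Assume in addition that $K$ is compact, that $A$ is a separating subspace of $C(K)$ and that $f$ is a nonzero element of $A$. Then the norm of $A$ is Gâteaux differentiable at $f$ if and only if $f$ is a strong peak function. In this case (that is, for $K$ compact Hausdorff and $A$ separating), the set of all weak-$*$ exposed points of $B_{A^*}$ is $\{\alpha\delta_t : t\in\rho A,\ \alpha\in\mathbb{C},\ |\alpha|=1\}$.
   Context: $C_b(K)$ is the complex Banach space of all bounded continuous complex-valued functions on $K$ with the sup norm ($=C(K)$ if $K$ is compact). "Subspace" means closed linear subspace. A nonzero $f\in A$ is a strong peak function if there is exactly one $x\in K$ with $|f(x)|=\|f\|$ and for every neighborhood $V$ of $x$ there is $\delta>0$ such that $|f(y)|\le\|f\|-\delta$ for all $y\in K\setminus V$; then $x$ is called a strong peak point for $A$. $\rho A$ is the set of all strong peak points for $A$. For $t\in K$, $\delta_t(f)=f(t)$ is evaluation at $t$. $A$ is separating if for all distinct $t,s\in K$ and all complex $\alpha,\beta$ of modulus $1$, $\alpha\delta_t\ne\beta\delta_s$ as functionals on $A$. "Every norming sequence of $f$ approaches for $A$" means: whenever $\{x_n\}$, $\{y_n\}$ are sequences in $K$ and $\alpha,\beta$ are complex numbers of modulus $1$ with $\lim_n\alpha f(x_n)=\|f\|=\lim_n\beta f(y_n)$, one has $\lim_n(\alpha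 g(x_n)-\beta g(y_n))=0$ for every $g\in A$. The norm of a Banach space $X$ is Gâteaux differentiable at $x$ if $\lim_{t\to0}\frac{\|x+ty\|+\|x-ty\|-2\|x\|}{t}=0$ ($t$ real) for every $y\in X$. A point $x^*\in B_{X^*}$ is a weak-$*$ exposed point of $B_{X^*}$ if there is $x\in S_X$ such that $1=\operatorname{Re}x^*(x)>\operatorname{Re}y^*(x)$ for all $y^*\in B_{X^*}\setminus\{x^*\}$. *)

theory Defs
  imports "HOL-Analysis.Analysis" "HOL-Library.FuncSet"
begin

text \<open>
  The space \<open>C\<^sub>b(K)\<close> is the type of bounded continuous functions \<open>'a \<Rightarrow>\<^sub>C complex\<close>, normed by the
  supremum norm, where \<open>K\<close> is the universe of a type of class \<open>t2_space\<close>. The library only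
  provides its structure as a real normed space; complex scalars are added here.
\<close>

definition cscale :: "complex \<Rightarrow> ('a::topological_space \<Rightarrow>\<^sub>C complex) \<Rightarrow> ('a \<Rightarrow>\<^sub>C complex)" where
  "cscale c f = Bcontfun (\<lambda>x. c * apply_bcontfun f x)"

lemma apply_bcontfun_cscale: "apply_bcontfun (cscale c f) x = c * apply_bcontfun f x"
proof -
  have "bounded ((\<lambda>z. c * z) ` range (apply_bcontfun f))"
    by (intro bounded_linear_image bounded_linear_mult_right) simp
  then have "(\<lambda>x. c * apply_bcontfun f x) \<in> bcontfun"
    by (auto simp: bcontfun_def image_image intro!: continuous_intros)
  then show ?thesis
    by (simp add: cscale_def Bcontfun_inverse)
qed

definition closed_csubspace :: "('a::topological_space \<Rightarrow>\<^sub>C complex) set \<Rightarrow> bool" where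
  "closed_csubspace A \<longleftrightarrow> closed A \<and> 0 \<in> A \<and> (\<forall>f\<in>A. \<forall>g\<in>A. f + g \<in> A) \<and> (\<forall>c. \<forall>f\<in>A. cscale c f \<in> A)"

definition strong_peak_at ::
  "('a::topological_space \<Rightarrow>\<^sub>C complex) set \<Rightarrow> ('a \<Rightarrow>\<^sub>C complex) \<Rightarrow> 'a \<Rightarrow> bool" where
  "strong_peak_at A f x \<longleftrightarrow>
     f \<in> A \<and> f \<noteq> 0 \<and>
     norm (apply_bcontfun f x) = norm f \<and>
     (\<forall>y. norm (apply_bcontfun f y) = norm f \<longrightarrow> y = x) \<and>
     (\<forall>V. x \<in> interior V \<longrightarrow> (\<exists>\<delta>>0. \<forall>y\<in>-V. norm (apply_bcontfun f y) \<le> norm f - \<delta>))"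

definition strong_peak_function ::
  "('a::topological_space \<Rightarrow>\<^sub>C complex) set \<Rightarrow> ('a \<Rightarrow>\<^sub>C complex) \<Rightarrow> bool" where
  "strong_peak_function A f \<longleftrightarrow> (\<exists>x. strong_peak_at A f x)"

definition strong_peak_points :: "('a::topological_space \<Rightarrow>\<^sub>C complex) set \<Rightarrow> 'a set" where
  "strong_peak_points A = {x. \<exists>f. strong_peak_at A f x}"

definition norming_sequences_approach ::
  "('a::topological_space \<Rightarrow>\<^sub>C complex) set \<Rightarrow> ('a \<Rightarrow>\<^sub>C complex) \<Rightarrow> bool" where
  "norming_sequences_approach A f \<longleftrightarrow>
     (\<forall>(x :: nat \<Rightarrow> 'a) (y :: nat \<Rightarrow> 'a) \<alpha> \<beta>.
        norm \<alpha> = 1 \<and> norm \<beta> = 1 \<and>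
        (\<lambda>n. \<alpha> * apply_bcontfun f (x n)) \<longlonglongrightarrow> complex_of_real (norm f) \<and>
        (\<lambda>n. \<beta> * apply_bcontfun f (y n)) \<longlonglongrightarrow> complex_of_real (norm f) \<longrightarrow>
        (\<forall>g\<in>A. (\<lambda>n. \<alpha> * apply_bcontfun g (x n) - \<beta> * apply_bcontfun g (y n)) \<longlonglongrightarrow> 0))"

definition gateaux_differentiable_norm_on :: "'b::real_normed_vector set \<Rightarrow> 'b \<Rightarrow> bool" where
  "gateaux_differentiable_norm_on X x \<longleftrightarrow>
     (\<forall>y\<in>X. ((\<lambda>t::real. (norm (x + t *\<^sub>R y) + norm (x - t *\<^sub>R y) - 2 * norm x) / t) \<longlongrightarrow> 0) (at 0))"

text \<open>
  Since \<open>A\<close> is a set, a functional on \<open>A\<close> is represented by a function that is \<open>undefined\<close> outside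
  \<open>A\<close>, so that equality of functionals is equality on \<open>A\<close>.
\<close>

definition dual :: "('a::topological_space \<Rightarrow>\<^sub>C complex) set \<Rightarrow> (('a \<Rightarrow>\<^sub>C complex) \<Rightarrow> complex) set" where
  "dual A = {\<phi> \<in> extensional A.
     (\<forall>f\<in>A. \<forall>g\<in>A. \<phi> (f + g) = \<phi> f + \<phi> g) \<and>
     (\<forall>c. \<forall>f\<in>A. \<phi> (cscale c f) = c * \<phi> f) \<and>
     (\<exists>C. \<forall>f\<in>A. norm (\<phi> f) \<le> C * norm f)}"

definition dual_norm ::
  "('a::topological_space \<Rightarrow>\<^sub>C complex) set \<Rightarrow> (('a \<Rightarrow>\<^sub>C complex) \<Rightarrow> complex) \<Rightarrow> real" where
  "dual_norm A \<phi> = (SUP f\<in>{f\<in>A. norm f \<le> 1}. norm (\<phi> f))"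

definition dual_ball ::
  "('a::topological_space \<Rightarrow>\<^sub>C complex) set \<Rightarrow> (('a \<Rightarrow>\<^sub>C complex) \<Rightarrow> complex) set" where
  "dual_ball A = {\<phi> \<in> dual A. dual_norm A \<phi> \<le> 1}"

definition evaluation ::
  "('a::topological_space \<Rightarrow>\<^sub>C complex) set \<Rightarrow> 'a \<Rightarrow> ('a \<Rightarrow>\<^sub>C complex) \<Rightarrow> complex" where
  "evaluation A t = (\<lambda>f\<in>A. apply_bcontfun f t)"

definition functional_scale ::
  "('a::topological_space \<Rightarrow>\<^sub>C complex) set \<Rightarrow> complex \<Rightarrow> (('a \<Rightarrow>\<^sub>C complex) \<Rightarrow> complex)
    \<Rightarrow> ('a \<Rightarrow>\<^sub>C complex) \<Rightarrow> complex" where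
  "functional_scale A \<alpha> \<phi> = (\<lambda>f\<in>A. \<alpha> * \<phi> f)"

definition separating :: "('a::topological_space \<Rightarrow>\<^sub>C complex) set \<Rightarrow> bool" where
  "separating A \<longleftrightarrow>
     (\<forall>t s \<alpha> \<beta>. t \<noteq> s \<and> norm \<alpha> = 1 \<and> norm \<beta> = 1 \<longrightarrow>
        functional_scale A \<alpha> (evaluation A t) \<noteq> functional_scale A \<beta> (evaluation A s))"

definition weak_star_exposed_point ::
  "('a::topological_space \<Rightarrow>\<^sub>C complex) set \<Rightarrow> (('a \<Rightarrow>\<^sub>C complex) \<Rightarrow> complex) \<Rightarrow> bool" where
  "weak_star_exposed_point A \<phi> \<longleftrightarrow>
     \<phi> \<in> dual_ball A \<and>
     (\<exists>f\<in>A. norm f = 1 \<and> Re (\<phi> f) = 1 \<and> (\<forall>\<psi> \<in> dual_ball A - {\<phi>}. Re (\<psi> f) < 1))"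

end

theory Submission
  imports Defs
begin

text \<open>
  At a strong peak function \<open>f\<close> with peak point \<open>x\<close>, the identity
  \<open>\<bar>f y + u g y\<bar> = Re (w (f y + u g y)) \<le> \<bar>f y\<bar> + u Re (w g y)\<close>, with \<open>w\<close> the conjugate sign of
  \<open>f y + u g y\<close>, shows that the norm has the directional derivative \<open>Re (cnj (sgn (f x)) g x)\<close> in
  direction \<open>g\<close>: near \<open>x\<close> the sign \<open>w\<close> is close to \<open>cnj (sgn (f x))\<close>, and away from \<open>x\<close> the function
  \<open>f\<close> stays below its norm by a fixed amount. Conversely, Gateaux differentiability at \<open>f\<close> forces the
  norm-one functional supporting the ball at \<open>f\<close> to be unique. On a compact space rotated evaluations
  at points of maximal modulus are such functionals, so a separating \<open>A\<close> leaves room for a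
  single such point; the same uniqueness describes the weak-* exposed points.
\<close>

section \<open>Scalars, signs and evaluation\<close>

lemma cscale_of_real: "cscale (complex_of_real r) f = r *\<^sub>R f"
  by (rule bcontfun_eqI) (simp add: apply_bcontfun_cscale scaleR_conv_of_real)

lemma norm_cscale_le: "norm (cscale c f) \<le> norm c * norm f"
  by (rule norm_bound) (simp only: apply_bcontfun_cscale norm_mult mult_left_mono norm_bounded norm_ge_zero)

lemma closed_csubspace_scaleR:
  assumes "closed_csubspace A" "f \<in> A"
  shows "r *\<^sub>R f \<in> A"
proof -
  have "cscale (complex_of_real r) f \<in> A"
    using assms unfolding closed_csubspace_def by blast
  then show ?thesis by (simp add: cscale_of_real)
qed

lemma norm_cnj_sgn_mult:
  fixes z :: complex
  shows "cnj (sgn z) * z = complex_of_real (norm z)"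
proof (cases "z = 0")
  case False
  have "cnj (sgn z) * z = (z * cnj z) / complex_of_real (norm z)"
    by (simp add: sgn_eq mult.commute)
  also have "z * cnj z = complex_of_real (norm z) * complex_of_real (norm z)"
    by (simp only: complex_norm_square[symmetric] power2_eq_square of_real_mult)
  finally show ?thesis using False by simp
qed simp

text \<open>The filter is arbitrary because the limit is taken along sequences as well as along a
  product of neighbourhood filters.\<close>

lemma tendsto_apply_bcontfun:
  assumes "(z \<longlongrightarrow> x) F"
  shows "((\<lambda>n. apply_bcontfun f (z n)) \<longlongrightarrow> apply_bcontfun f x) F"
proof -
  have "((apply_bcontfun f) \<longlongrightarrow> apply_bcontfun f x) (nhds x)"
    using continuous_on_apply_bcontfun[of UNIV f]
    by (simp add: continuous_on_def tendsto_at_iff_tendsto_nhds)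
  then show ?thesis using assms by (rule filterlim_compose)
qed

section \<open>Norming sequences of strong peak functions\<close>

text \<open>The peak condition in filter form: \<open>P\<close> can be any closeness statement
  obtained from a limit at \<open>x\<close>.\<close>

lemma strong_peak_at_eventually_bounded_away:
  assumes "strong_peak_at A f x" and "eventually P (nhds x)"
  obtains \<delta> where "\<delta> > 0" "\<And>y. \<not> P y \<Longrightarrow> norm (apply_bcontfun f y) \<le> norm f - \<delta>"
proof -
  obtain V where "open V" "x \<in> V" and V: "\<And>y. y \<in> V \<Longrightarrow> P y"
    using assms(2) unfolding eventually_nhds by blast
  then have "x \<in> interior V" by (simp add: interior_open)
  then obtain \<delta> where "\<delta> > 0" "\<forall>y\<in>-V. norm (apply_bcontfun f y) \<le> norm f - \<delta>"
    using assms(1) unfolding strong_peak_at_def by blast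
  then show thesis using V by (intro that[of \<delta>]) auto
qed

text \<open>Outside a neighbourhood of \<open>x\<close> the modulus of \<open>f\<close> stays below
  \<open>norm f\<close> by a fixed gap, so values close to \<open>norm f\<close> force the argument
  into that neighbourhood.\<close>

lemma strong_peak_at_norming_tendsto:
  assumes peak: "strong_peak_at A f x"
    and lim: "((\<lambda>n. norm (apply_bcontfun f (z n))) \<longlongrightarrow> norm f) F"
  shows "(z \<longlongrightarrow> x) F"
proof (rule topological_tendstoI)
  fix S assume "open S" "x \<in> S"
  then have "eventually (\<lambda>y. y \<in> S) (nhds x)" by (rule eventually_nhds_in_open)
  then obtain \<delta> where "\<delta> > 0" and \<delta>: "\<And>y. y \<notin> S \<Longrightarrow> norm (apply_bcontfun f y) \<le> norm f - \<delta>"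
    using strong_peak_at_eventually_bounded_away[OF peak] by metis
  have "eventually (\<lambda>n. norm (apply_bcontfun f (z n)) > norm f - \<delta>) F"
    using lim \<open>\<delta> > 0\<close> by (intro order_tendstoD(1)) auto
  then show "eventually (\<lambda>n. z n \<in> S) F"
    by eventually_elim (use \<delta> in force)
qed

text \<open>The moduli alone give convergence to \<open>x\<close>; continuity of \<open>f\<close>
  then pins down the rotation \<alpha> through the value \<open>f x\<close>.\<close>

lemma strong_peak_at_rotated_sequence:
  assumes peak: "strong_peak_at A f x" and "norm \<alpha> = 1"
    and lim: "(\<lambda>n. \<alpha> * apply_bcontfun f (z n)) \<longlonglongrightarrow> complex_of_real (norm f)"
  shows "z \<longlonglongrightarrow> x" and "\<alpha> * apply_bcontfun f x = complex_of_real (norm f)"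
proof -
  have "(\<lambda>n. norm (apply_bcontfun f (z n))) \<longlonglongrightarrow> norm f"
    using tendsto_norm[OF lim] \<open>norm \<alpha> = 1\<close> by (simp add: norm_mult)
  then show z: "z \<longlonglongrightarrow> x" by (rule strong_peak_at_norming_tendsto[OF peak])
  have "(\<lambda>n. \<alpha> * apply_bcontfun f (z n)) \<longlonglongrightarrow> \<alpha> * apply_bcontfun f x"
    by (intro tendsto_mult_left tendsto_apply_bcontfun z)
  then show "\<alpha> * apply_bcontfun f x = complex_of_real (norm f)"
    using lim by (rule LIMSEQ_unique)
qed

text \<open>Both sequences converge to the peak point, and both rotations are determined by the
  nonzero value there, so they agree and the two limits cancel.\<close>

lemma strong_peak_function_norming_sequences_approach:
  assumes "strong_peak_function A f"
  shows "norming_sequences_approach A f"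
  unfolding norming_sequences_approach_def
proof (intro allI impI ballI)
  fix z y :: "nat \<Rightarrow> 'a" and \<alpha> \<beta> g
  obtain x where x: "strong_peak_at A f x" using assms unfolding strong_peak_function_def by blast
  assume "norm \<alpha> = 1 \<and> norm \<beta> = 1 \<and>
    (\<lambda>n. \<alpha> * apply_bcontfun f (z n)) \<longlonglongrightarrow> complex_of_real (norm f) \<and>
    (\<lambda>n. \<beta> * apply_bcontfun f (y n)) \<longlonglongrightarrow> complex_of_real (norm f)"
  then have z: "z \<longlonglongrightarrow> x" "\<alpha> * apply_bcontfun f x = complex_of_real (norm f)"
    and y: "y \<longlonglongrightarrow> x" "\<beta> * apply_bcontfun f x = complex_of_real (norm f)"
    using strong_peak_at_rotated_sequence[OF x] by blast+
  have "apply_bcontfun f x \<noteq> 0" using x unfolding strong_peak_at_def by auto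
  then have "\<alpha> = \<beta>" using z(2) y(2) by (metis mult_right_cancel)
  have "(\<lambda>n. \<alpha> * apply_bcontfun g (z n) - \<beta> * apply_bcontfun g (y n)) \<longlonglongrightarrow>
      \<alpha> * apply_bcontfun g x - \<beta> * apply_bcontfun g x"
    by (intro tendsto_diff tendsto_mult_left tendsto_apply_bcontfun z(1) y(1))
  then show "(\<lambda>n. \<alpha> * apply_bcontfun g (z n) - \<beta> * apply_bcontfun g (y n)) \<longlonglongrightarrow> 0"
    using \<open>\<alpha> = \<beta>\<close> by simp
qed

section \<open>Gateaux differentiability at strong peak functions\<close>

text \<open>An upper bound suffices, since convexity of the norm supplies the lower one. It covers
  both signs of \<open>u\<close>, so it can be added to its copy at \<open>-u\<close>.\<close>

lemma strong_peak_at_directional_bound: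
  assumes peak: "strong_peak_at A f x" and "\<epsilon> > 0"
  shows "eventually (\<lambda>u::real. norm (f + u *\<^sub>R g)
    \<le> norm f + u * Re (cnj (sgn (apply_bcontfun f x)) * apply_bcontfun g x) + \<bar>u\<bar> * \<epsilon>) (nhds 0)"
proof -
  \<comment> \<open>\<open>h y u\<close> is the slope term of the identity for
    \<open>norm (f y + u * g y)\<close>, and \<open>L = h x 0\<close> is the candidate
    derivative.\<close>
  define h where "h y u = Re (cnj (sgn (apply_bcontfun f y + of_real u * apply_bcontfun g y))
    * apply_bcontfun g y)" for y and u :: real
  define L where "L = h x 0"
  have fx: "apply_bcontfun f x \<noteq> 0" using peak unfolding strong_peak_at_def by auto
  have lim: "((\<lambda>p. apply_bcontfun k (fst p)) \<longlongrightarrow> apply_bcontfun k x) (nhds x \<times>\<^sub>F nhds (0::real))"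
    for k :: "'a \<Rightarrow>\<^sub>C complex"
    by (intro tendsto_apply_bcontfun filterlim_fst)
  have limu: "((\<lambda>p. complex_of_real (snd p)) \<longlongrightarrow> complex_of_real 0) (nhds x \<times>\<^sub>F nhds (0::real))"
    by (intro tendsto_of_real filterlim_snd)
  \<comment> \<open>The limit is joint in \<open>y\<close> and \<open>u\<close>, so that the
    neighbourhood of \<open>x\<close> given by \<open>P\<close> does not depend on \<open>u\<close>.
    The sign is continuous at the limit point because \<open>f x\<close> is nonzero.\<close>
  have "((\<lambda>p. h (fst p) (snd p)) \<longlongrightarrow> L) (nhds x \<times>\<^sub>F nhds 0)"
    unfolding h_def L_def by (intro tendsto_intros tendsto_sgn lim limu) (use fx in simp)
  then have "eventually (\<lambda>p. dist (h (fst p) (snd p)) L < \<epsilon>) (nhds x \<times>\<^sub>F nhds 0)"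
    using \<open>\<epsilon> > 0\<close> by (rule tendstoD)
  then obtain P Q where P: "eventually P (nhds x)" and Q: "eventually Q (nhds (0::real))"
    and PQ: "\<And>y u. P y \<Longrightarrow> Q u \<Longrightarrow> dist (h y u) L < \<epsilon>"
    unfolding eventually_prod_filter by auto
  obtain \<delta> where "\<delta> > 0" and \<delta>: "\<And>y. \<not> P y \<Longrightarrow> norm (apply_bcontfun f y) \<le> norm f - \<delta>"
    using strong_peak_at_eventually_bounded_away[OF peak P] by blast
  \<comment> \<open>Off \<open>P\<close> the perturbation adds at most
    \<open>\<bar>u\<bar> * norm g\<close>, while the claimed bound may drop by
    \<open>\<bar>u\<bar> * \<bar>L\<bar>\<close>; the gap \<delta> has to absorb both.\<close>
  have "((\<lambda>u. \<bar>u\<bar> * (norm g + \<bar>L\<bar>)) \<longlongrightarrow> \<bar>0\<bar> * (norm g + \<bar>L\<bar>)) (nhds (0::real))"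
    by (intro tendsto_intros filterlim_ident)
  then have "eventually (\<lambda>u::real. \<bar>u\<bar> * (norm g + \<bar>L\<bar>) < \<delta>) (nhds 0)"
    using \<open>\<delta> > 0\<close> by (intro order_tendstoD(2)) auto
  then have "eventually (\<lambda>u. norm (f + u *\<^sub>R g) \<le> norm f + u * L + \<bar>u\<bar> * \<epsilon>) (nhds 0)"
    using Q
  proof eventually_elim
    case (elim u)
    show ?case
    proof (rule norm_bound)
      fix y
      let ?z = "apply_bcontfun f y + of_real u * apply_bcontfun g y"
      have eq: "apply_bcontfun (f + u *\<^sub>R g) y = ?z" by (simp add: scaleR_conv_of_real)
      have "norm ?z \<le> norm f + u * L + \<bar>u\<bar> * \<epsilon>"
      proof (cases "P y")
        case True
        then have d: "\<bar>h y u - L\<bar> \<le> \<epsilon>" using PQ elim by (force simp: dist_real_def)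
        have "norm ?z = Re (cnj (sgn ?z) * ?z)" by (simp add: norm_cnj_sgn_mult)
        also have "\<dots> = Re (cnj (sgn ?z) * apply_bcontfun f y) + u * h y u"
          unfolding h_def by (simp add: algebra_simps)
        also have "Re (cnj (sgn ?z) * apply_bcontfun f y) \<le> norm (apply_bcontfun f y)"
          by (rule order_trans[OF complex_Re_le_cmod])
            (simp add: norm_mult norm_sgn)
        also have "\<dots> \<le> norm f" by (rule norm_bounded)
        also have "u * h y u \<le> u * L + \<bar>u\<bar> * \<epsilon>"
        proof -
          have "u * (h y u - L) \<le> \<bar>u\<bar> * \<bar>h y u - L\<bar>" by (metis abs_ge_self abs_mult)
          also have "\<dots> \<le> \<bar>u\<bar> * \<epsilon>" using d by (rule mult_left_mono) simp
          finally show ?thesis by (simp add: algebra_simps)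
        qed
        finally show ?thesis by simp
      next
        case False
        have "norm ?z \<le> norm (apply_bcontfun f y) + \<bar>u\<bar> * norm (apply_bcontfun g y)"
          by (metis norm_triangle_ineq norm_mult norm_of_real)
        also have "\<dots> \<le> (norm f - \<delta>) + \<bar>u\<bar> * norm g"
          by (intro add_mono \<delta> False mult_left_mono norm_bounded) simp
        also have "\<dots> \<le> norm f - \<bar>u\<bar> * \<bar>L\<bar>" using elim(1) by (simp add: algebra_simps)
        also have "\<dots> \<le> norm f + u * L" by (metis abs_ge_minus_self abs_mult add_left_mono
              diff_conv_add_uminus minus_le_iff)
        also have "\<dots> \<le> norm f + u * L + \<bar>u\<bar> * \<epsilon>" using \<open>\<epsilon> > 0\<close> by simp
        finally show ?thesis .
      qed
      then show "norm (apply_bcontfun (f + u *\<^sub>R g) y) \<le> norm f + u * L + \<bar>u\<bar> * \<epsilon>"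
        unfolding eq .
    qed
  qed
  then show ?thesis unfolding L_def h_def by simp
qed

lemma strong_peak_function_gateaux:
  assumes "strong_peak_function A f"
  shows "gateaux_differentiable_norm_on X f"
  unfolding gateaux_differentiable_norm_on_def
proof
  fix g
  obtain x where x: "strong_peak_at A f x" using assms unfolding strong_peak_function_def by blast
  show "((\<lambda>t. (norm (f + t *\<^sub>R g) + norm (f - t *\<^sub>R g) - 2 * norm f) / t) \<longlongrightarrow> 0) (at 0)"
  proof (rule tendstoI)
    fix \<epsilon> :: real assume "\<epsilon> > 0"
    define L where "L = Re (cnj (sgn (apply_bcontfun f x)) * apply_bcontfun g x)"
    \<comment> \<open>Adding the bounds at \<open>u\<close> and \<open>-u\<close> cancels the linear
      terms and leaves an error of two thirds of \<open>\<epsilon> * \<bar>u\<bar>\<close>, which is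
      strictly below \<open>\<epsilon> * \<bar>u\<bar>\<close>.\<close>
    have ev: "eventually (\<lambda>u. norm (f + u *\<^sub>R g) \<le> norm f + u * L + \<bar>u\<bar> * (\<epsilon> / 3)) (nhds 0)"
      unfolding L_def using \<open>\<epsilon> > 0\<close> by (intro strong_peak_at_directional_bound[OF x]) simp
    moreover have "filterlim uminus (nhds 0) (nhds (0::real))"
      using tendsto_minus[OF filterlim_ident, of "0::real"] by simp
    ultimately have "eventually (\<lambda>u. norm (f + (- u) *\<^sub>R g)
        \<le> norm f + (- u) * L + \<bar>- u\<bar> * (\<epsilon> / 3)) (nhds 0)"
      by (rule eventually_compose_filterlim)
    then have "eventually (\<lambda>u. norm (f + (- u) *\<^sub>R g)
        \<le> norm f + (- u) * L + \<bar>- u\<bar> * (\<epsilon> / 3)) (at 0)"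
      and "eventually (\<lambda>u. norm (f + u *\<^sub>R g) \<le> norm f + u * L + \<bar>u\<bar> * (\<epsilon> / 3)) (at 0)"
      using ev by (auto simp: eventually_at_filter elim: eventually_mono)
    moreover have "eventually (\<lambda>u::real. u \<noteq> 0) (at 0)" by (simp add: eventually_at_filter)
    ultimately show "eventually (\<lambda>t. dist ((norm (f + t *\<^sub>R g) + norm (f - t *\<^sub>R g) - 2 * norm f) / t) 0 < \<epsilon>) (at 0)"
    proof eventually_elim
      case (elim u)
      let ?q = "norm (f + u *\<^sub>R g) + norm (f - u *\<^sub>R g) - 2 * norm f"
      have "norm ((f + u *\<^sub>R g) + (f - u *\<^sub>R g)) \<le> norm (f + u *\<^sub>R g) + norm (f - u *\<^sub>R g)"
        by (rule norm_triangle_ineq)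
      moreover have "(f + u *\<^sub>R g) + (f - u *\<^sub>R g) = 2 *\<^sub>R f" by (simp add: scaleR_2)
      ultimately have "?q \<ge> 0" by simp
      moreover have "?q \<le> 2 * (\<bar>u\<bar> * (\<epsilon> / 3))" using elim by simp
      moreover have "2 * (\<bar>u\<bar> * (\<epsilon> / 3)) < \<epsilon> * \<bar>u\<bar>" using elim \<open>\<epsilon> > 0\<close> by simp
      ultimately have "\<bar>?q\<bar> < \<epsilon> * \<bar>u\<bar>" by linarith
      then show ?case using elim(3) by (simp add: dist_real_def abs_divide pos_divide_less_eq)
    qed
  qed
qed

section \<open>The dual ball and rotated evaluations\<close>

lemma dual_scaleR:
  assumes "\<phi> \<in> dual A" "f \<in> A"
  shows "\<phi> (r *\<^sub>R f) = of_real r * \<phi> f"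
proof -
  have "\<phi> (cscale (complex_of_real r) f) = of_real r * \<phi> f"
    using assms unfolding dual_def by blast
  then show ?thesis by (simp add: cscale_of_real)
qed

lemma dual_ball_norm_le:
  assumes A: "closed_csubspace A" and \<phi>: "\<phi> \<in> dual_ball A" and f: "f \<in> A"
  shows "norm (\<phi> f) \<le> norm f"
proof -
  have \<phi>': "\<phi> \<in> dual A" "dual_norm A \<phi> \<le> 1" using \<phi> unfolding dual_ball_def by auto
  obtain C where C: "\<And>g. g \<in> A \<Longrightarrow> norm (\<phi> g) \<le> C * norm g"
    using \<phi>'(1) unfolding dual_def by blast
  have scale: "\<phi> (r *\<^sub>R f) = of_real r * \<phi> f" for r
    using \<phi>'(1) f by (rule dual_scaleR)
  show ?thesis
  proof (cases "f = 0")
    case True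
    then show ?thesis using C[OF f] by simp
  next
    case False
    \<comment> \<open>A real supremum dominates its members only when the set is bounded above; the
      constant \<open>C\<close> from membership in \<open>dual A\<close> provides this.\<close>
    have "bdd_above ((\<lambda>g. norm (\<phi> g)) ` {g\<in>A. norm g \<le> 1})"
    proof (rule bdd_aboveI2)
      fix g assume g: "g \<in> {g\<in>A. norm g \<le> 1}"
      then have "norm (\<phi> g) \<le> C * norm g" using C by simp
      also have "\<dots> \<le> \<bar>C\<bar> * 1" using g by (intro mult_mono) auto
      finally show "norm (\<phi> g) \<le> \<bar>C\<bar>" by simp
    qed
    then have "norm (\<phi> ((1 / norm f) *\<^sub>R f)) \<le> dual_norm A \<phi>"
      unfolding dual_norm_def
      using closed_csubspace_scaleR[OF A f] False by (intro cSUP_upper) auto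
    then have "norm (\<phi> ((1 / norm f) *\<^sub>R f)) \<le> 1" using \<phi>'(2) by linarith
    then show ?thesis using False by (simp add: scale norm_mult norm_divide field_simps)
  qed
qed

lemma rotated_evaluation_apply:
  "f \<in> A \<Longrightarrow> functional_scale A \<alpha> (evaluation A t) f = \<alpha> * apply_bcontfun f t"
  by (simp add: functional_scale_def evaluation_def)

lemma rotated_evaluation_in_dual_ball:
  assumes A: "closed_csubspace A" and "norm \<alpha> = 1"
  shows "functional_scale A \<alpha> (evaluation A t) \<in> dual_ball A"
proof -
  let ?\<phi> = "functional_scale A \<alpha> (evaluation A t)"
  have le: "norm (?\<phi> f) \<le> norm f" if "f \<in> A" for f
    using that \<open>norm \<alpha> = 1\<close> by (simp add: rotated_evaluation_apply norm_mult norm_bounded)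
  have "?\<phi> \<in> extensional A" by (simp add: functional_scale_def)
  moreover have "\<exists>C. \<forall>f\<in>A. norm (?\<phi> f) \<le> C * norm f"
    using le by (intro exI[of _ 1]) simp
  ultimately have "?\<phi> \<in> dual A"
    using A unfolding dual_def closed_csubspace_def
    by (simp add: rotated_evaluation_apply apply_bcontfun_cscale algebra_simps)
  moreover have "dual_norm A ?\<phi> \<le> 1"
    unfolding dual_norm_def
  proof (rule cSUP_least)
    have "0 \<in> A" using A unfolding closed_csubspace_def by blast
    then have "0 \<in> {f \<in> A. norm f \<le> 1}" by simp
    then show "{f \<in> A. norm f \<le> 1} \<noteq> {}" by blast
  qed (use le in force)
  ultimately show ?thesis unfolding dual_ball_def by simp
qed

section \<open>Uniqueness of supporting functionals\<close>

text \<open>Supporting functionals are subgradients of the norm at \<open>f\<close>. Using \<phi> at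
  \<open>t\<close> and \<psi> at \<open>-t\<close> bounds
  \<open>Re (\<phi> g) - Re (\<psi> g)\<close> by the second difference quotient, which tends to
  0.\<close>

lemma gateaux_supporting_Re_le:
  assumes A: "closed_csubspace A" and f: "f \<in> A" and diff: "gateaux_differentiable_norm_on A f"
    and \<phi>: "\<phi> \<in> dual_ball A" "Re (\<phi> f) = norm f"
    and \<psi>: "\<psi> \<in> dual_ball A" "Re (\<psi> f) = norm f"
    and g: "g \<in> A"
  shows "Re (\<phi> g) \<le> Re (\<psi> g)"
proof -
  have support: "norm f + u * Re (\<theta> g) \<le> norm (f + u *\<^sub>R g)"
    if \<theta>: "\<theta> \<in> dual_ball A" "Re (\<theta> f) = norm f" for \<theta> u
  proof -
    have ug: "u *\<^sub>R g \<in> A" using closed_csubspace_scaleR[OF A g] .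
    then have sum: "f + u *\<^sub>R g \<in> A" using A f unfolding closed_csubspace_def by blast
    have "\<theta> (f + u *\<^sub>R g) = \<theta> f + \<theta> (u *\<^sub>R g)"
      using \<theta>(1) f ug unfolding dual_ball_def dual_def by blast
    also have "\<theta> (u *\<^sub>R g) = of_real u * \<theta> g"
      using \<theta>(1) g unfolding dual_ball_def by (blast intro: dual_scaleR)
    finally have "norm f + u * Re (\<theta> g) = Re (\<theta> (f + u *\<^sub>R g))" using \<theta>(2) by simp
    also have "\<dots> \<le> norm (\<theta> (f + u *\<^sub>R g))" by (rule complex_Re_le_cmod)
    also have "\<dots> \<le> norm (f + u *\<^sub>R g)" by (rule dual_ball_norm_le[OF A \<theta>(1) sum])
    finally show ?thesis .
  qed
  let ?q = "\<lambda>t. (norm (f + t *\<^sub>R g) + norm (f - t *\<^sub>R g) - 2 * norm f) / t"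
  \<comment> \<open>Only positive \<open>t\<close> are considered, so that division by
    \<open>t\<close> preserves the inequality.\<close>
  have "(?q \<longlongrightarrow> 0) (at_right 0)"
    using diff g unfolding gateaux_differentiable_norm_on_def
    by (blast intro: tendsto_mono[OF at_le[OF subset_UNIV]])
  moreover have "eventually (\<lambda>t. Re (\<phi> g) - Re (\<psi> g) \<le> ?q t) (at_right (0::real))"
    using eventually_at_right_less[of "0::real"]
  proof eventually_elim
    case (elim t)
    have "t * (Re (\<phi> g) - Re (\<psi> g)) \<le> norm (f + t *\<^sub>R g) + norm (f - t *\<^sub>R g) - 2 * norm f"
      using support[OF \<phi>, of t] support[OF \<psi>, of "- t"] by (simp add: algebra_simps)
    then show ?case using elim by (simp add: field_simps)
  qed
  ultimately have "Re (\<phi> g) - Re (\<psi> g) \<le> 0"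
    by (intro tendsto_lowerbound) auto
  then show ?thesis by simp
qed

text \<open>Exchanging \<phi> and \<psi> gives equal real parts; equality of imaginary parts follows
  by testing with \<i> times \<open>g\<close>.\<close>

lemma gateaux_supporting_functional_unique:
  assumes A: "closed_csubspace A" and f: "f \<in> A" and diff: "gateaux_differentiable_norm_on A f"
    and \<phi>: "\<phi> \<in> dual_ball A" "Re (\<phi> f) = norm f"
    and \<psi>: "\<psi> \<in> dual_ball A" "Re (\<psi> f) = norm f"
  shows "\<phi> = \<psi>"
proof (rule extensionalityI)
  show "\<phi> \<in> extensional A" "\<psi> \<in> extensional A"
    using \<phi>(1) \<psi>(1) unfolding dual_ball_def dual_def by auto
next
  fix g assume g: "g \<in> A"
  have re: "Re (\<phi> h) = Re (\<psi> h)" if "h \<in> A" for h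
    using gateaux_supporting_Re_le[OF A f diff \<phi> \<psi> that]
      gateaux_supporting_Re_le[OF A f diff \<psi> \<phi> that] by simp
  have ig: "cscale \<i> g \<in> A" using A g unfolding closed_csubspace_def by blast
  have "\<phi> (cscale \<i> g) = \<i> * \<phi> g" "\<psi> (cscale \<i> g) = \<i> * \<psi> g"
    using \<phi>(1) \<psi>(1) g unfolding dual_ball_def dual_def by blast+
  then have "Im (\<phi> g) = Im (\<psi> g)" using re[OF ig] by simp
  then show "\<phi> g = \<psi> g" using re[OF g] by (rule complex_eqI[rotated])
qed

section \<open>Peak points on compact spaces\<close>

lemma norm_attained_on_compact:
  fixes f :: "'a::topological_space \<Rightarrow>\<^sub>C complex"
  assumes "compact (UNIV :: 'a set)"
  obtains t where "norm (apply_bcontfun f t) = norm f"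
proof -
  have "continuous_on UNIV (\<lambda>t. norm (apply_bcontfun f t))"
    by (intro continuous_on_norm continuous_on_apply_bcontfun)
  then obtain t where t: "\<And>s. norm (apply_bcontfun f s) \<le> norm (apply_bcontfun f t)"
    using continuous_attains_sup[OF assms] by auto
  have "norm f \<le> norm (apply_bcontfun f t)" by (rule norm_bound) (rule t)
  then show thesis using norm_bounded[of f t] by (intro that[of t]) simp
qed

text \<open>By compactness the modulus has a maximum off a neighbourhood of \<open>x\<close>.
  Uniqueness of \<open>x\<close> makes this maximum strictly smaller than \<open>norm f\<close>, and
  the difference serves as \<delta>.\<close>

lemma strong_peak_at_compactI:
  fixes A :: "('a::topological_space \<Rightarrow>\<^sub>C complex) set"
  assumes K: "compact (UNIV :: 'a set)" and "f \<in> A" "f \<noteq> 0"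
    and x: "norm (apply_bcontfun f x) = norm f"
    and uniq: "\<And>y. norm (apply_bcontfun f y) = norm f \<Longrightarrow> y = x"
  shows "strong_peak_at A f x"
  unfolding strong_peak_at_def
proof (intro conjI allI impI)
  fix V assume V: "x \<in> interior V"
  show "\<exists>\<delta>>0. \<forall>y\<in>-V. norm (apply_bcontfun f y) \<le> norm f - \<delta>"
  proof (cases "- interior V = {}")
    \<comment> \<open>There is no maximum over the empty set; the condition is then vacuous and 1 is
      an arbitrary choice of \<delta>.\<close>
    case True
    then have "- V = {}" using interior_subset by blast
    then show ?thesis by (intro exI[of _ 1]) simp
  next
    case False
    \<comment> \<open>Passing from \<open>- V\<close> to the larger set \<open>- interior V\<close>
      yields a closed set, as \<open>V\<close> need not be open.\<close>
    have "compact (- interior V)"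
      using compact_Int_closed[OF K, of "- interior V"] by (simp add: closed_Compl)
    moreover have "continuous_on (- interior V) (\<lambda>t. norm (apply_bcontfun f t))"
      by (intro continuous_on_norm continuous_on_apply_bcontfun)
    ultimately obtain t where t: "t \<in> - interior V"
      "\<And>s. s \<in> - interior V \<Longrightarrow> norm (apply_bcontfun f s) \<le> norm (apply_bcontfun f t)"
      using continuous_attains_sup[OF _ False] by metis
    have "norm (apply_bcontfun f t) \<noteq> norm f" using uniq t(1) V by auto
    then have "norm (apply_bcontfun f t) < norm f" using norm_bounded[of f t] by simp
    then show ?thesis
      using t(2) interior_subset[of V]
      by (intro exI[of _ "norm f - norm (apply_bcontfun f t)"]) auto
  qed
qed (rule assms | assumption)+

text \<open>The conjugate sign of \<open>f t\<close> rotates the value \<open>f t\<close> onto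
  \<open>norm f\<close>.\<close>

lemma supporting_evaluation:
  assumes A: "closed_csubspace A" and "f \<in> A" "f \<noteq> 0" "norm (apply_bcontfun f t) = norm f"
  obtains \<alpha> where "norm \<alpha> = 1" "functional_scale A \<alpha> (evaluation A t) \<in> dual_ball A"
    "Re (functional_scale A \<alpha> (evaluation A t) f) = norm f"
proof (rule that)
  let ?\<alpha> = "cnj (sgn (apply_bcontfun f t))"
  have "apply_bcontfun f t \<noteq> 0" using assms by auto
  then show 1: "norm ?\<alpha> = 1" by (simp add: norm_sgn)
  show "functional_scale A ?\<alpha> (evaluation A t) \<in> dual_ball A"
    by (rule rotated_evaluation_in_dual_ball[OF A 1])
  show "Re (functional_scale A ?\<alpha> (evaluation A t) f) = norm f"
    using assms by (simp add: rotated_evaluation_apply norm_cnj_sgn_mult)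
qed

text \<open>Every point of maximal modulus carries a rotated evaluation supporting at
  \<open>f\<close>. All of these equal \<phi>, so separation allows only one such point. This serves
  both the differentiability criterion and the exposed points.\<close>

lemma unique_support_imp_strong_peak_at:
  fixes A :: "('a::topological_space \<Rightarrow>\<^sub>C complex) set"
  assumes A: "closed_csubspace A" and K: "compact (UNIV :: 'a set)" and sep: "separating A"
    and f: "f \<in> A" "f \<noteq> 0"
    and uniq: "\<And>\<psi>. \<psi> \<in> dual_ball A \<Longrightarrow> Re (\<psi> f) = norm f \<Longrightarrow> \<psi> = \<phi>"
  obtains \<alpha> t where "norm \<alpha> = 1" "\<phi> = functional_scale A \<alpha> (evaluation A t)"
    "strong_peak_at A f t"
proof -
  obtain t where t: "norm (apply_bcontfun f t) = norm f"
    using norm_attained_on_compact[OF K] .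
  obtain \<alpha> where \<alpha>: "norm \<alpha> = 1" "functional_scale A \<alpha> (evaluation A t) = \<phi>"
    using supporting_evaluation[OF A f t] uniq by metis
  have "s = t" if s: "norm (apply_bcontfun f s) = norm f" for s
  proof -
    obtain \<beta> where "norm \<beta> = 1" "functional_scale A \<beta> (evaluation A s) = \<phi>"
      using supporting_evaluation[OF A f s] uniq by metis
    then show ?thesis using \<alpha> sep unfolding separating_def by metis
  qed
  then have "strong_peak_at A f t" using strong_peak_at_compactI[OF K f t] by blast
  then show thesis using \<alpha> that by blast
qed

lemma gateaux_imp_strong_peak_function:
  fixes A :: "('a::topological_space \<Rightarrow>\<^sub>C complex) set"
  assumes A: "closed_csubspace A" and K: "compact (UNIV :: 'a set)" and sep: "separating A"
    and f: "f \<in> A" "f \<noteq> 0" and diff: "gateaux_differentiable_norm_on A f"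
  shows "strong_peak_function A f"
proof -
  obtain t where t: "norm (apply_bcontfun f t) = norm f"
    using norm_attained_on_compact[OF K] .
  obtain \<alpha> where \<alpha>: "functional_scale A \<alpha> (evaluation A t) \<in> dual_ball A"
    "Re (functional_scale A \<alpha> (evaluation A t) f) = norm f"
    using supporting_evaluation[OF A f t] by blast
  obtain s where "strong_peak_at A f s"
  proof (rule unique_support_imp_strong_peak_at[OF A K sep f])
    show "\<psi> = functional_scale A \<alpha> (evaluation A t)"
      if "\<psi> \<in> dual_ball A" "Re (\<psi> f) = norm f" for \<psi>
      by (rule gateaux_supporting_functional_unique[OF A f(1) diff that \<alpha>])
  qed
  then show ?thesis unfolding strong_peak_function_def by blast
qed

section \<open>Weak-* exposed points\<close>

lemma strong_peak_at_cscale: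
  assumes A: "closed_csubspace A" and peak: "strong_peak_at A f x" and c: "norm c * norm f = 1"
  shows "strong_peak_at A (cscale c f) x" and "norm (cscale c f) = 1"
proof -
  have c0: "norm c > 0" using c by auto
  have fx: "norm (apply_bcontfun f x) = norm f" using peak unfolding strong_peak_at_def by blast
  \<comment> \<open>The value at \<open>x\<close> has modulus \<open>norm c * norm f = 1\<close>,
    which squeezes the norm between 1 and 1.\<close>
  have "norm (apply_bcontfun (cscale c f) x) \<le> norm (cscale c f)" by (rule norm_bounded)
  then show n: "norm (cscale c f) = 1"
    using norm_cscale_le[of c f] c fx by (simp add: apply_bcontfun_cscale norm_mult)
  show "strong_peak_at A (cscale c f) x"
    unfolding strong_peak_at_def n apply_bcontfun_cscale norm_mult
  proof (intro conjI allI impI)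
    show "cscale c f \<in> A" using A peak unfolding closed_csubspace_def strong_peak_at_def by blast
    show "cscale c f \<noteq> 0" using n by auto
    show "norm c * norm (apply_bcontfun f x) = 1" using c fx by simp
  next
    fix y assume "norm c * norm (apply_bcontfun f y) = 1"
    then have "norm (apply_bcontfun f y) = norm f" using c c0 by (metis mult_left_cancel less_irrefl)
    then show "y = x" using peak unfolding strong_peak_at_def by blast
  next
    fix V assume "x \<in> interior V"
    then obtain \<delta> where "\<delta> > 0" and \<delta>: "\<forall>y\<in>-V. norm (apply_bcontfun f y) \<le> norm f - \<delta>"
      using peak unfolding strong_peak_at_def by blast
    have "norm c * norm (apply_bcontfun f y) \<le> 1 - norm c * \<delta>" if "y \<in> - V" for y
    proof -
      have "norm c * norm (apply_bcontfun f y) \<le> norm c * (norm f - \<delta>)"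
        using \<delta> that by (intro mult_left_mono) auto
      then show ?thesis using c by (simp add: algebra_simps)
    qed
    then show "\<exists>\<delta>>0. \<forall>y\<in>-V. norm c * norm (apply_bcontfun f y) \<le> 1 - \<delta>"
      using \<open>\<delta> > 0\<close> c0 by (intro exI[of _ "norm c * \<delta>"]) simp
  qed
qed

text \<open>A suitably scaled peak function exposes the rotated evaluation: the norm is
  differentiable at it, hence no other functional in the ball supports there.\<close>

lemma strong_peak_point_imp_weak_star_exposed:
  assumes A: "closed_csubspace A" and t: "t \<in> strong_peak_points A" and \<alpha>: "norm \<alpha> = 1"
  shows "weak_star_exposed_point A (functional_scale A \<alpha> (evaluation A t))" (is "weak_star_exposed_point A ?\<phi>")
proof -
  obtain f where f: "strong_peak_at A f t" using t unfolding strong_peak_points_def by blast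
  then have ft: "norm (apply_bcontfun f t) = norm f" "f \<noteq> 0" unfolding strong_peak_at_def by auto
  then have ft0: "apply_bcontfun f t \<noteq> 0" by auto
  \<comment> \<open>The factor fixes modulus and phase at once: \<open>norm g = 1\<close> and
    \<alpha> times \<open>g t\<close> equals 1.\<close>
  define g where "g = cscale (1 / (\<alpha> * apply_bcontfun f t)) f"
  have g: "strong_peak_at A g t" "norm g = 1"
    unfolding g_def using ft \<alpha> by (auto intro!: strong_peak_at_cscale[OF A f] simp: norm_mult norm_divide)
  have gA: "g \<in> A" using g(1) unfolding strong_peak_at_def by blast
  have "\<alpha> \<noteq> 0" using \<alpha> by auto
  then have \<phi>g: "Re (?\<phi> g) = 1"
    unfolding rotated_evaluation_apply[OF gA] unfolding g_def apply_bcontfun_cscale using ft0 by simp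
  have ball: "?\<phi> \<in> dual_ball A" by (rule rotated_evaluation_in_dual_ball[OF A \<alpha>])
  have diff: "gateaux_differentiable_norm_on A g"
    using g(1) strong_peak_function_gateaux unfolding strong_peak_function_def by blast
  have "Re (\<psi> g) < 1" if \<psi>: "\<psi> \<in> dual_ball A - {?\<phi>}" for \<psi>
  proof -
    have "Re (\<psi> g) \<le> 1"
      using complex_Re_le_cmod[of "\<psi> g"] dual_ball_norm_le[OF A _ gA, of \<psi>] \<psi> g(2) by auto
    moreover have "Re (\<psi> g) \<noteq> 1"
      using gateaux_supporting_functional_unique[OF A gA diff _ _ ball, of \<psi>] \<psi> \<phi>g g(2) by auto
    ultimately show ?thesis by simp
  qed
  then show ?thesis unfolding weak_star_exposed_point_def using ball gA g(2) \<phi>g by blast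
qed

text \<open>The exposing function \<open>f\<close> has \<phi> as its only possible supporting
  functional, so it peaks strongly at a point whose rotated evaluation is \<phi>.\<close>

lemma weak_star_exposed_imp_strong_peak_point:
  fixes A :: "('a::topological_space \<Rightarrow>\<^sub>C complex) set"
  assumes A: "closed_csubspace A" and K: "compact (UNIV :: 'a set)" and sep: "separating A"
    and "weak_star_exposed_point A \<phi>"
  obtains \<alpha> t where "norm \<alpha> = 1" "\<phi> = functional_scale A \<alpha> (evaluation A t)"
    "t \<in> strong_peak_points A"
proof -
  obtain f where f: "f \<in> A" "norm f = 1"
    and exp: "\<And>\<psi>. \<psi> \<in> dual_ball A - {\<phi>} \<Longrightarrow> Re (\<psi> f) < 1"
    using assms(4) unfolding weak_star_exposed_point_def by blast
  have "f \<noteq> 0" using f(2) by auto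
  moreover have "\<psi> = \<phi>" if "\<psi> \<in> dual_ball A" "Re (\<psi> f) = norm f" for \<psi>
    using exp[of \<psi>] that f(2) by auto
  ultimately show thesis
    using unique_support_imp_strong_peak_at[OF A K sep f(1), of \<phi>] that
    unfolding strong_peak_points_def by blast
qed

theorem proposition2p5:
  fixes A :: "('a::t2_space \<Rightarrow>\<^sub>C complex) set"
  assumes "closed_csubspace A"
  shows "(\<forall>f. strong_peak_function A f \<longrightarrow>
            norming_sequences_approach A f \<and> gateaux_differentiable_norm_on A f) \<and>
         (compact (UNIV :: 'a set) \<and> separating A \<longrightarrow>
            (\<forall>f\<in>A. f \<noteq> 0 \<longrightarrow> (gateaux_differentiable_norm_on A f \<longleftrightarrow> strong_peak_function A f)) \<and>
            {\<phi>. weak_star_exposed_point A \<phi>} =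
              {functional_scale A \<alpha> (evaluation A t) | \<alpha> t. t \<in> strong_peak_points A \<and> norm \<alpha> = 1})"
proof (intro conjI allI impI ballI)
  fix f assume "strong_peak_function A f"
  then show "norming_sequences_approach A f" "gateaux_differentiable_norm_on A f"
    by (rule strong_peak_function_norming_sequences_approach strong_peak_function_gateaux)+
next
  fix f assume "compact (UNIV :: 'a set) \<and> separating A" "f \<in> A" "f \<noteq> 0"
  then show "gateaux_differentiable_norm_on A f \<longleftrightarrow> strong_peak_function A f"
    using gateaux_imp_strong_peak_function[OF assms] strong_peak_function_gateaux by blast
next
  assume K: "compact (UNIV :: 'a set) \<and> separating A"
  show "{\<phi>. weak_star_exposed_point A \<phi>} =
    {functional_scale A \<alpha> (evaluation A t) | \<alpha> t. t \<in> strong_peak_points A \<and> norm \<alpha> = 1}"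
  proof (intro subset_antisym subsetI)
    fix \<phi> assume "\<phi> \<in> {\<phi>. weak_star_exposed_point A \<phi>}"
    then obtain \<alpha> t where "norm \<alpha> = 1" "\<phi> = functional_scale A \<alpha> (evaluation A t)"
      "t \<in> strong_peak_points A"
      using weak_star_exposed_imp_strong_peak_point[OF assms] K by blast
    then show "\<phi> \<in> {functional_scale A \<alpha> (evaluation A t) | \<alpha> t.
        t \<in> strong_peak_points A \<and> norm \<alpha> = 1}" by blast
  qed (use strong_peak_point_imp_weak_star_exposed[OF assms] in blast)
qed

end
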